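(* Let $G=(V,E)$ be a $\delta$-regular equatorial graph with girth $3$ and equator $q$. Then $q\equiv 0\pmod 3$ or $\delta\equiv 2\pmod 3$. Moreover, $V$ can be partitioned into $q$ parts $L_0,\dots,L_{q-1}$, each inducing a clique, such that $E$ consists exactly of the edges inside the parts together with all edges $uv$ with $u\in L_i$, $v\in L_{i+1}$ (indices mod $q$). Furthermore: if $q\equiv0\pmod 3$, there are positive integers $n_0,n_1,n_2$ with $n_0+n_1+n_2=\delta+1$ and $|L_i|=n_j$ whenever $i\equiv j\pmod 3$; if $q\not\equiv0\pmod3$, then $|L_i|=\frac{\delta+1}{3}$ for all $i$.
   Context: A cycle $C$ in $G$ is isometric if $d_C(x,y)=d_G(x,y)$ for all $x,y\in V(C)$; the equator is the length of a longest isometric cycle. For $\delta\ge2$, $g\ge3$, $k=\lceil g/2\rceil-1$, the Moore bound is $M(\delta,g)=1+\sum_{i=0}^{k-1}\delta(\delta-1)^i$ for odd $g$ and $M(\delta,g)=2+\sum_{i=1}^{k}2(\delta-1)^i$ for even $g$ (so $M(\delta,3)=\delta+1$). An equatorial graph is a finite graph with girth $g$, minimum degree $\delta$ and equator $q>6k+3$ whose order is exactly $\frac{q}{g}M(\delta,g)$; for $g=3$ this means $q>9$ and order $\frac{q(\delta+1)}{3}$. *)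

theory Defs
  imports
    "Graph_Theory.Graph_Theory"
    "HOL-Library.Extended_Nat"
    "HOL-Library.Disjoint_Sets"
    "HOL-Number_Theory.Cong"
begin

text \<open>
  A finite simple graph is an AFP \<^locale>\<open>pair_graph\<close>: finite, loopless and without parallel arcs,
  an undirected edge \<open>uv\<close> being the pair of arcs \<open>(u,v)\<close> and \<open>(v,u)\<close>.
  Hence the degree of a vertex is its \<^const>\<open>out_degree\<close>.
\<close>

definition regular :: "'a pair_pre_digraph \<Rightarrow> nat \<Rightarrow> bool" where
  "regular G d \<longleftrightarrow> (\<forall>v\<in>pverts G. out_degree (with_proj G) v = d)"

definition min_degree :: "'a pair_pre_digraph \<Rightarrow> nat" where
  "min_degree G = Min (out_degree (with_proj G) ` pverts G)"

definition graph_dist :: "'a pair_pre_digraph \<Rightarrow> 'a \<Rightarrow> 'a \<Rightarrow> ereal" where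
  "graph_dist G = wf_digraph.\<mu> (with_proj G) (\<lambda>_. 1)"

text \<open>
  The library counts the closed walk \<open>(u,v), (v,u)\<close> as a cycle, so a length of at least 3 is required.
  A cycle is given by its list of arcs; its length is the length of the list.
\<close>

definition graph_cycle :: "'a pair_pre_digraph \<Rightarrow> ('a \<times> 'a) list \<Rightarrow> bool" where
  "graph_cycle G p \<longleftrightarrow> pre_digraph.cycle (with_proj G) p \<and> 3 \<le> length p"

definition girth :: "'a pair_pre_digraph \<Rightarrow> enat" where
  "girth G = (INF p\<in>{p. graph_cycle G p}. enat (length p))"

text \<open>The vertices of a closed walk are the tails of its arcs.\<close>

definition cycle_graph :: "('a \<times> 'a) list \<Rightarrow> 'a pair_pre_digraph" where
  "cycle_graph p = \<lparr>pverts = fst ` set p, parcs = set p \<union> (set p)\<inverse>\<rparr>"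

definition isometric_cycle :: "'a pair_pre_digraph \<Rightarrow> ('a \<times> 'a) list \<Rightarrow> bool" where
  "isometric_cycle G p \<longleftrightarrow> graph_cycle G p \<and>
     (\<forall>x\<in>pverts (cycle_graph p). \<forall>y\<in>pverts (cycle_graph p).
        graph_dist (cycle_graph p) x y = graph_dist G x y)"

text \<open>
  In a finite graph the cycle lengths are bounded, so the supremum is a maximum
  (it is \<open>0\<close> if there is no cycle at all).
\<close>

definition equator :: "'a pair_pre_digraph \<Rightarrow> enat" where
  "equator G = (SUP p\<in>{p. isometric_cycle G p}. enat (length p))"

definition moore_radius :: "nat \<Rightarrow> nat" where
  "moore_radius g = nat (\<lceil>real g / 2\<rceil> - 1)"

definition moore_bound :: "nat \<Rightarrow> nat \<Rightarrow> nat" where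
  "moore_bound d g =
     (if odd g then 1 + (\<Sum>i<moore_radius g. d * (d - 1) ^ i)
      else 2 + (\<Sum>i=1..moore_radius g. 2 * (d - 1) ^ i))"

lemma moore_bound_girth_3: "moore_bound d 3 = d + 1"
proof -
  have "\<lceil>3 / 2 :: real\<rceil> = 2" by linarith
  then show ?thesis by (simp add: moore_bound_def moore_radius_def)
qed

definition equatorial_graph :: "'a pair_pre_digraph \<Rightarrow> nat \<Rightarrow> nat \<Rightarrow> nat \<Rightarrow> bool" where
  "equatorial_graph G d g q \<longleftrightarrow>
     pair_graph G \<and> 2 \<le> d \<and> 3 \<le> g \<and>
     girth G = enat g \<and> min_degree G = d \<and> equator G = enat q \<and>
     q > 6 * moore_radius g + 3 \<and>
     real (card (pverts G)) = real q / real g * real (moore_bound d g)"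

definition induces_clique :: "'a pair_pre_digraph \<Rightarrow> 'a set \<Rightarrow> bool" where
  "induces_clique G S \<longleftrightarrow> complete_digraph (card S) (induce_subgraph (with_proj G) S)"

end

theory Submission
  imports Defs
begin

text \<open>
  Let \<open>c\<^sub>0, \<dots>, c\<^sub>q\<^sub>-\<^sub>1\<close> be an isometric cycle. A closed neighbourhood \<open>N[v]\<close> has diameter at most 2, so it
  contains at most three vertices of the cycle, and these lie among three consecutive ones. Double counting,
  \<open>\<Sum>\<^sub>i |N[c\<^sub>i]| = q (\<delta> + 1) = 3 |V|\<close> forces exactly three for every \<open>v\<close>; the middle one determines
  the layer of \<open>v\<close>. As the cycle is isometric, edges only join equal or consecutive layers, so for
  \<open>u\<close> in layer \<open>i\<close> the set \<open>N[u]\<close> is contained in the union of the layers \<open>i - 1, i, i + 1\<close>, which is \<open>N[c\<^sub>i]\<close>.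
  By regularity the two are equal. Hence three consecutive layers have total size \<open>\<delta> + 1\<close>, and
  layer sizes are 3-periodic.
\<close>

section \<open>Congruences and short walks along an isometric cycle\<close>

text \<open>Isometry locates cycle vertices only modulo \<open>q\<close>; offsets small compared
  with \<open>q\<close> are recovered exactly.\<close>

lemma dvd_imp_eq_of_abs_less:
  fixes q x y :: int
  assumes "q dvd x - y" and "\<bar>x - y\<bar> < q"
  shows "x = y"
  using assms dvd_imp_le_int[of "x - y" q] by fastforce

text \<open>The cycle is indexed by all integers with period \<open>q\<close>; \<open>iso\<close> says that a walk of length at most \<open>k\<close>
  (a power of the reflexive closure) cannot advance by more than \<open>k\<close> along it.\<close>

locale isometric_ring =
  fixes V :: "'a set" and E :: "'a rel" and c :: "int \<Rightarrow> 'a" and q d :: nat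
  assumes finite_V: "finite V"
    and E_sub: "E \<subseteq> V \<times> V"
    and sym_E: "sym E"
    and irrefl_E: "irrefl E"
    and q_ge: "10 \<le> q"
    and c_eq_iff: "c x = c y \<longleftrightarrow> int q dvd x - y"
    and c_step: "(c x, c (x + 1)) \<in> E"
    and iso: "(c x, c y) \<in> (E\<^sup>=) ^^ k \<Longrightarrow> \<exists>m. \<bar>m\<bar> \<le> int k \<and> int q dvd y - x - m"
    and degree: "v \<in> V \<Longrightarrow> card (E `` {v}) = d"
    and card_V: "3 * card V = q * (d + 1)"
begin

lemma symD_refl: "(u, v) \<in> E\<^sup>= \<Longrightarrow> (v, u) \<in> E\<^sup>="
  using sym_E by (auto dest: symD)

lemma c_in_V: "c x \<in> V"
  using c_step E_sub by blast

lemma near2: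
  assumes "(c x, v) \<in> E\<^sup>=" "(v, c y) \<in> E\<^sup>="
  obtains m where "\<bar>m\<bar> \<le> 2" "int q dvd y - x - m"
proof -
  have "(c x, c y) \<in> (E\<^sup>=) ^^ 2"
    unfolding numeral_2_eq_2
    by (rule relpow_Suc_I[OF relpow_Suc_I[OF relpow_0_I assms(1)] assms(2)])
  from iso[OF this] show thesis using that by auto
qed

lemma near3:
  assumes "(c x, u) \<in> E\<^sup>=" "(u, v) \<in> E\<^sup>=" "(v, c y) \<in> E\<^sup>="
  obtains m where "\<bar>m\<bar> \<le> 3" "int q dvd y - x - m"
proof -
  have "(c x, c y) \<in> (E\<^sup>=) ^^ 3"
    unfolding numeral_3_eq_3
    by (rule relpow_Suc_I[OF relpow_Suc_I[OF relpow_Suc_I[OF relpow_0_I assms(1)] assms(2)] assms(3)])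
  from iso[OF this] show thesis using that by auto
qed

section \<open>Closed neighbourhoods and their contacts with the cycle\<close>

definition nbhd :: "'a \<Rightarrow> 'a set" where "nbhd v = E\<^sup>= `` {v}"

lemma nbhd_subset: "v \<in> V \<Longrightarrow> nbhd v \<subseteq> V"
  using E_sub by (auto simp: nbhd_def)

lemma finite_nbhd: "v \<in> V \<Longrightarrow> finite (nbhd v)"
  using nbhd_subset finite_V finite_subset by blast

lemma card_nbhd: "v \<in> V \<Longrightarrow> card (nbhd v) = d + 1"
proof -
  assume v: "v \<in> V"
  have "nbhd v = insert v (E `` {v})" by (auto simp: nbhd_def)
  moreover have "v \<notin> E `` {v}" using irrefl_E by (auto simp: irrefl_def)
  moreover have "finite (E `` {v})"
    using E_sub finite_V by (blast intro: finite_subset)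
  ultimately show ?thesis using degree[OF v] by simp
qed

text \<open>Indices run over a single period, so each vertex of the cycle is counted once.\<close>

definition contacts :: "'a \<Rightarrow> int set" where
  "contacts v = {i \<in> {0..<int q}. (c i, v) \<in> E\<^sup>=}"

lemma finite_contacts: "finite (contacts v)"
  by (rule finite_subset[of _ "{0..<int q}"]) (auto simp: contacts_def)

lemma c_cong: "int q dvd x - y \<Longrightarrow> c x = c y"
  using c_eq_iff by blast

lemma c_mod: "c (x mod int q) = c x"
  by (rule c_cong) (simp add: mod_eq_dvd_iff[symmetric])

text \<open>All contacts lift to integer offsets in \<open>{-2..2}\<close> from one of them; any two
  offsets again differ by at most 2, so three consecutive integers contain them all.\<close>

lemma contacts_consecutive:
  obtains x where "contacts v \<subseteq> (\<lambda>m. (x + m) mod int q) ` {-1..1}"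
proof (cases "contacts v = {}")
  case True
  then show thesis using that by simp
next
  case False
  then obtain x where x: "(c x, v) \<in> E\<^sup>=" by (auto simp: contacts_def)
  define M where "M = {m \<in> {-2..2}. (c (x + m), v) \<in> E\<^sup>=}"
  have close: "\<bar>m - m'\<bar> \<le> 2" if M: "m \<in> M" "m' \<in> M" for m m'
  proof -
    obtain k where k: "\<bar>k\<bar> \<le> 2" "int q dvd (x + m) - (x + m') - k"
      using near2[of "x + m'" v "x + m", OF _ symD_refl[of "c (x + m)" v]] M
      unfolding M_def by blast
    \<comment> \<open>\<open>m - m'\<close> is at most 4 and \<open>k\<close> at most 2 in absolute
      value, and 6 is below \<open>q\<close>.\<close>
    have "m - m' = k"
      using M k q_ge by (intro dvd_imp_eq_of_abs_less[of "int q"]) (auto simp: M_def)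
    then show ?thesis using k by simp
  qed
  have cover: "\<exists>m\<in>M. i = (x + m) mod int q" if "i \<in> contacts v" for i
  proof -
    have i: "0 \<le> i" "i < int q" "(c i, v) \<in> E\<^sup>=" using that by (auto simp: contacts_def)
    obtain m where m: "\<bar>m\<bar> \<le> 2" "int q dvd i - x - m"
      using near2[OF x symD_refl[OF i(3)]] by blast
    have d: "int q dvd i - (x + m)" using m(2) by (simp add: algebra_simps)
    have "c (x + m) = c i" using c_cong[OF d] by simp
    moreover have "i = (x + m) mod int q"
      using d i by (metis mod_eq_dvd_iff mod_pos_pos_trivial)
    ultimately show ?thesis using m i by (intro bexI[of _ m]) (auto simp: M_def)
  qed
  have "\<exists>e. M \<subseteq> {e - 1..e + 1}"
  proof (cases "M = {}")
    case False
    have "finite M" by (rule finite_subset[of _ "{-2..2}"]) (auto simp: M_def)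
    then have "Min M \<in> M" "\<And>m. m \<in> M \<Longrightarrow> Min M \<le> m" using False by auto
    then have "M \<subseteq> {Min M + 1 - 1..Min M + 1 + 1}" using close[of _ "Min M"] by force
    then show ?thesis by blast
  qed simp
  then obtain e where e: "M \<subseteq> {e - 1..e + 1}" by blast
  show thesis
  proof (rule that[of "x + e"], rule subsetI)
    fix i assume "i \<in> contacts v"
    then obtain m where "m \<in> M" "i = (x + m) mod int q" using cover by blast
    then show "i \<in> (\<lambda>m. (x + e + m) mod int q) ` {-1..1}"
      using e by (intro image_eqI[of _ _ "m - e"]) auto
  qed
qed

lemma card_contacts_le: "card (contacts v) \<le> 3"
proof -
  obtain x where x: "contacts v \<subseteq> (\<lambda>m. (x + m) mod int q) ` {-1..1}"
    by (rule contacts_consecutive)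
  have "card (contacts v) \<le> card ((\<lambda>m. (x + m) mod int q) ` {-1..1})"
    by (rule card_mono[OF _ x]) simp
  also have "\<dots> \<le> card {-1..1::int}" by (rule card_image_le) simp
  finally show ?thesis by simp
qed

lemma card_contacts:
  assumes "v \<in> V"
  shows "card (contacts v) = 3"
proof -
  have "(\<Sum>v\<in>V. card (contacts v)) = (\<Sum>v\<in>V. \<Sum>i\<in>{0..<int q}. if (c i, v) \<in> E\<^sup>= then 1 else 0)"
    by (simp add: contacts_def sum.If_cases Int_def)
  also have "\<dots> = (\<Sum>i\<in>{0..<int q}. \<Sum>v\<in>V. if (c i, v) \<in> E\<^sup>= then 1 else 0)"
    by (rule sum.swap)
  also have "\<dots> = (\<Sum>i\<in>{0..<int q}. card (nbhd (c i)))"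
  proof (rule sum.cong[OF refl])
    fix i
    have "nbhd (c i) = V \<inter> {v. (c i, v) \<in> E\<^sup>=}"
      using nbhd_subset[OF c_in_V[of i]] by (auto simp: nbhd_def)
    then show "(\<Sum>v\<in>V. if (c i, v) \<in> E\<^sup>= then 1 else 0) = card (nbhd (c i))"
      by (simp add: sum.If_cases finite_V)
  qed
  also have "\<dots> = (\<Sum>v\<in>V. 3)"
    using card_V by (simp add: card_nbhd c_in_V)
  finally have eq: "(\<Sum>v\<in>V. card (contacts v)) = (\<Sum>v\<in>V. 3)" .
  show ?thesis
  proof (rule ccontr)
    assume "card (contacts v) \<noteq> 3"
    \<comment> \<open>No other vertex can make up for a deficit, because 3 is the maximum
      everywhere.\<close>
    then have "card (contacts v) < 3" using card_contacts_le[of v] by simp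
    then have "(\<Sum>v\<in>V. card (contacts v)) < (\<Sum>v\<in>V. 3)"
      using assms finite_V card_contacts_le by (intro sum_strict_mono_ex1) auto
    then show False using eq by simp
  qed
qed

section \<open>Layers: existence and disjointness\<close>

text \<open>Indexing by all integers keeps the adjacent layers at \<open>i - 1\<close> and
  \<open>i + 1\<close> without reduction modulo \<open>q\<close>.\<close>

definition layer :: "int \<Rightarrow> 'a set" where
  "layer i = {v. \<forall>m\<in>{-1..1}. (c (i + m), v) \<in> E\<^sup>=}"

lemma layerD:
  assumes "v \<in> layer i"
  shows "(c (i - 1), v) \<in> E\<^sup>=" "(c i, v) \<in> E\<^sup>=" "(c (i + 1), v) \<in> E\<^sup>="
proof -
  have "\<forall>m\<in>{-1..1}. (c (i + m), v) \<in> E\<^sup>=" using assms by (simp add: layer_def)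
  from this[rule_format, of "-1"] this[rule_format, of 0] this[rule_format, of 1]
  show "(c (i - 1), v) \<in> E\<^sup>=" "(c i, v) \<in> E\<^sup>=" "(c (i + 1), v) \<in> E\<^sup>=" by auto
qed

lemma layer_subset: "layer i \<subseteq> V"
  using layerD(2) nbhd_subset[OF c_in_V] by (auto simp: nbhd_def)

lemma finite_layer: "finite (layer i)"
  using layer_subset finite_V finite_subset by blast

lemma layer_cong:
  assumes "int q dvd i - j"
  shows "layer i = layer j"
proof -
  have "c (i + m) = c (j + m)" for m by (rule c_cong) (use assms in simp)
  then show ?thesis by (simp add: layer_def)
qed

lemma layer_mod: "layer (i mod int q) = layer i"
  by (rule layer_cong) (simp add: mod_eq_dvd_iff[symmetric])

text \<open>Three contacts inside a window of at most three indices fill it; its centre is the index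
  of the layer.\<close>

lemma ex_layer:
  assumes "v \<in> V"
  shows "\<exists>x. v \<in> layer x"
proof -
  obtain x where x: "contacts v \<subseteq> (\<lambda>m. (x + m) mod int q) ` {-1..1}"
    by (rule contacts_consecutive)
  have "card ((\<lambda>m. (x + m) mod int q) ` {-1..1}) \<le> card (contacts v)"
    using card_image_le[of "{-1..1::int}" "\<lambda>m. (x + m) mod int q"] card_contacts[OF assms] by simp
  then have "contacts v = (\<lambda>m. (x + m) mod int q) ` {-1..1}"
    using x by (intro card_seteq) auto
  then have "(c ((x + m) mod int q), v) \<in> E\<^sup>=" if "m \<in> {-1..1}" for m
    using that unfolding contacts_def by blast
  then show ?thesis unfolding layer_def c_mod by blast
qed

lemma c_in_layer: "c i \<in> layer i"
proof -
  have "(c (i - 1), c i) \<in> E" "(c (i + 1), c i) \<in> E"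
    using c_step[of "i - 1"] c_step[of i] sym_E by (auto dest: symD)
  moreover have "{-1..1::int} = {-1, 0, 1}" by auto
  ultimately show ?thesis by (auto simp: layer_def)
qed

text \<open>Going through \<open>v\<close> from \<open>i - 1\<close> to \<open>j + 1\<close> and
  from \<open>i + 1\<close> to \<open>j - 1\<close> shows that \<open>j - i + 2\<close> and
  \<open>j - i - 2\<close> are congruent to offsets of absolute value at most 2. These differ by 4,
  so they are 2 and -2.\<close>

lemma layer_disjoint:
  assumes "v \<in> layer i" "v \<in> layer j"
  shows "int q dvd j - i"
proof -
  obtain m where m: "\<bar>m\<bar> \<le> 2" "int q dvd (j + 1) - (i - 1) - m"
    using near2[OF layerD(1)[OF assms(1)] symD_refl[OF layerD(3)[OF assms(2)]]] by blast
  obtain m' where m': "\<bar>m'\<bar> \<le> 2" "int q dvd (j - 1) - (i + 1) - m'"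
    using near2[OF layerD(3)[OF assms(1)] symD_refl[OF layerD(1)[OF assms(2)]]] by blast
  have "int q dvd m - (m' + 4)" using dvd_diff[OF m'(2) m(2)] by (simp add: algebra_simps)
  then have "m = m' + 4" using m m' q_ge by (intro dvd_imp_eq_of_abs_less) auto
  then have "m = 2" using m m' by simp
  then show ?thesis using m by simp
qed

section \<open>Adjacency between layers\<close>

text \<open>The centres alone allow a shift \<open>m\<close> of up to 3 either way. Opposite extreme
  contacts add \<open>m + 2 \<le> 3\<close> and \<open>-3 \<le> m - 2\<close>.\<close>

lemma edge_layers:
  assumes "(u, v) \<in> E\<^sup>=" "u \<in> layer i" "v \<in> layer j"
  obtains m where "m \<in> {-1..1}" "int q dvd j - i - m"
proof -
  obtain m where m: "\<bar>m\<bar> \<le> 3" "int q dvd j - i - m"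
    using near3[OF layerD(2)[OF assms(2)] assms(1) symD_refl[OF layerD(2)[OF assms(3)]]] by blast
  obtain m1 where m1: "\<bar>m1\<bar> \<le> 3" "int q dvd (j + 1) - (i - 1) - m1"
    using near3[OF layerD(1)[OF assms(2)] assms(1) symD_refl[OF layerD(3)[OF assms(3)]]] by blast
  obtain m2 where m2: "\<bar>m2\<bar> \<le> 3" "int q dvd (j - 1) - (i + 1) - m2"
    using near3[OF layerD(3)[OF assms(2)] assms(1) symD_refl[OF layerD(1)[OF assms(3)]]] by blast
  have "int q dvd m1 - (m + 2)" "int q dvd m2 - (m - 2)"
    using dvd_diff[OF m(2) m1(2)] dvd_diff[OF m(2) m2(2)] by (simp_all add: algebra_simps)
  then have "m1 = m + 2" "m2 = m - 2"
    using m m1 m2 q_ge by (auto intro!: dvd_imp_eq_of_abs_less[of "int q"])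
  then show thesis using that[of m] m m1 m2 by simp
qed

definition block :: "int \<Rightarrow> 'a set" where
  "block i = layer (i - 1) \<union> layer i \<union> layer (i + 1)"

lemma nbhd_subset_block:
  assumes "u \<in> layer i"
  shows "nbhd u \<subseteq> block i"
proof
  fix v assume v: "v \<in> nbhd u"
  then have "v \<in> V" using nbhd_subset layer_subset assms by blast
  then obtain j where j: "v \<in> layer j" using ex_layer by blast
  have "(u, v) \<in> E\<^sup>=" using v by (simp add: nbhd_def)
  then obtain m where m: "m \<in> {-1..1}" "int q dvd j - i - m"
    using edge_layers assms j by metis
  then have "layer j = layer (i + m)" by (intro layer_cong) (simp add: algebra_simps)
  moreover have "m = -1 \<or> m = 0 \<or> m = 1" using m by auto
  ultimately show "v \<in> block i" using j by (auto simp: block_def)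
qed

text \<open>One inclusion is \<open>nbhd_subset_block\<close> at \<open>c i\<close>. Conversely,
  \<open>i\<close> lies in the contact window of each of the layers \<open>i - 1\<close>,
  \<open>i\<close> and \<open>i + 1\<close>.\<close>

lemma nbhd_c: "nbhd (c i) = block i"
  using nbhd_subset_block[OF c_in_layer, of i] layerD(1)[of _ "i + 1"] layerD(2)[of _ i]
    layerD(3)[of _ "i - 1"]
  by (auto simp: block_def nbhd_def)

text \<open>Regularity upgrades the inclusion: the block of \<open>i\<close> has the size of a closed neighbourhood,
  being that of \<open>c i\<close>.\<close>

lemma nbhd_eq_block:
  assumes "u \<in> layer i"
  shows "nbhd u = block i"
proof (rule card_subset_eq[OF _ nbhd_subset_block[OF assms]])
  have "u \<in> V" using assms layer_subset by blast
  then show "card (nbhd u) = card (block i)"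
    using card_nbhd c_in_V by (simp flip: nbhd_c)
  show "finite (block i)" by (simp add: block_def finite_layer)
qed

text \<open>Isometry gives the forward direction, regularity the converse through
  \<open>nbhd_eq_block\<close>. Closed neighbourhoods contain their centre, hence the separate
  \<open>u \<noteq> v\<close>.\<close>

lemma edge_iff:
  assumes "u \<in> layer i" "v \<in> layer j"
  shows "(u, v) \<in> E \<longleftrightarrow> u \<noteq> v \<and> (\<exists>m\<in>{-1..1}. int q dvd j - i - m)"
proof
  assume "(u, v) \<in> E"
  then show "u \<noteq> v \<and> (\<exists>m\<in>{-1..1}. int q dvd j - i - m)"
    using edge_layers[of u v i j] assms irrefl_E unfolding irrefl_def by blast
next
  assume a: "u \<noteq> v \<and> (\<exists>m\<in>{-1..1}. int q dvd j - i - m)"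
  then obtain m where m: "m \<in> {-1..1}" "int q dvd j - i - m" by blast
  have "layer j = layer (i + m)" by (rule layer_cong) (use m in \<open>simp add: algebra_simps\<close>)
  moreover have "m = -1 \<or> m = 0 \<or> m = 1" using m by auto
  ultimately have "v \<in> block i" using assms by (auto simp: block_def)
  then show "(u, v) \<in> E" using nbhd_eq_block[OF assms(1)] a by (auto simp: nbhd_def)
qed

section \<open>Sizes of the layers\<close>

text \<open>\<open>block i\<close> is the closed neighbourhood of \<open>c i\<close>; its three
  layers are disjoint since indices at most 2 apart are distinct modulo \<open>q\<close>.\<close>

lemma card_layers: "card (layer (i - 1)) + card (layer i) + card (layer (i + 1)) = d + 1"
proof -
  have disj: "layer x \<inter> layer y = {}" if "x < y" "y \<le> x + 2" for x y
    using that layer_disjoint[of _ x y] zdvd_imp_le[of "int q" "y - x"] q_ge by force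
  have "card (block i) = card (layer (i - 1)) + card (layer i) + card (layer (i + 1))"
    unfolding block_def using disj[of "i-1" i] disj[of "i-1" "i+1"] disj[of i "i+1"]
    by (simp add: card_Un_disjoint finite_layer Int_Un_distrib2)
  then show ?thesis using card_nbhd[OF c_in_V] by (simp flip: nbhd_c)
qed

text \<open>The windows centred at \<open>i + 1\<close> and \<open>i + 2\<close> have equal totals
  and share two layers.\<close>

lemma card_layer_3: "card (layer (i + 3)) = card (layer i)"
  using card_layers[of "i + 1"] card_layers[of "i + 2"] by (simp add: algebra_simps)

lemma card_layer_cong3:
  assumes "3 dvd i - j"
  shows "card (layer i) = card (layer j)"
proof -
  have nat: "card (layer (x + 3 * int k)) = card (layer x)" for x k
  proof (induction k)
    case (Suc k)
    then show ?case using card_layer_3[of "x + 3 * int k"] by (simp add: algebra_simps)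
  qed simp
  obtain t where t: "i = j + 3 * t" using assms by (metis dvdE diff_add_cancel add.commute)
  show ?thesis
  proof (cases "t \<ge> 0")
    case True
    then show ?thesis using nat[of j "nat t"] t by simp
  next
    case False
    then show ?thesis using nat[of i "nat (- t)"] t by simp
  qed
qed

text \<open>Layer sizes have the periods 3 and \<open>q\<close>, which are coprime here.\<close>

lemma card_layer_const:
  assumes "\<not> 3 dvd q"
  shows "card (layer i) = card (layer j)"
proof -
  \<comment> \<open>Modulo 3, both 1 and 2 are their own inverses, so \<open>t\<close> is
    \<open>i - j\<close> or \<open>2 * (i - j)\<close>.\<close>
  have "\<exists>t. 3 dvd i - (j + t * int q)"
  proof -
    have "int q mod 3 = 1 \<or> int q mod 3 = 2" using assms by presburger
    then show ?thesis
    proof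
      assume "int q mod 3 = 1"
      then have "3 dvd (i - j) * (1 - int q)" by (intro dvd_mult) presburger
      then have "3 dvd i - (j + (i - j) * int q)" by (simp add: algebra_simps)
      then show ?thesis by blast
    next
      assume "int q mod 3 = 2"
      then have "3 dvd (i - j) * (1 - 2 * int q)" by (intro dvd_mult) presburger
      then have "3 dvd i - (j + 2 * (i - j) * int q)" by (simp add: algebra_simps)
      then show ?thesis by blast
    qed
  qed
  then obtain t where "3 dvd i - (j + t * int q)" by blast
  then have "card (layer i) = card (layer (j + t * int q))" by (rule card_layer_cong3)
  also have "layer (j + t * int q) = layer j" by (rule layer_cong) simp
  finally show ?thesis .
qed

end

section \<open>Distances as powers of the reflexive adjacency relation\<close>

lemma relpow_refl_mono: "m \<le> n \<Longrightarrow> (x, y) \<in> (R\<^sup>=) ^^ m \<Longrightarrow> (x, y) \<in> (R\<^sup>=) ^^ n"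
  by (induction rule: dec_induct) auto

lemma (in pair_wf_digraph) awalk_cost_one: "awalk_cost (\<lambda>_. 1) p = real (length p)"
  by (induction p) auto

lemma (in pair_wf_digraph) awalk_relpow: "awalk u p v \<Longrightarrow> (u, v) \<in> ((parcs G)\<^sup>=) ^^ length p"
proof (induction p arbitrary: u)
  case (Cons e p)
  then have "(u, snd e) \<in> (parcs G)\<^sup>=" "awalk (snd e) p v"
    by (cases e; simp add: awalk_Cons_iff)+
  then show ?case using relpow_Suc_I2[OF _ Cons.IH] by simp
qed (simp add: awalk_Nil_iff)

lemma (in pair_wf_digraph) relpow_refl_awalk:
  assumes "x \<in> pverts G" "(x, y) \<in> ((parcs G)\<^sup>=) ^^ k"
  shows "\<exists>p. awalk x p y \<and> length p \<le> k"
  using assms(2)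
proof (induction k arbitrary: y)
  case 0
  then show ?case using assms(1) by (intro exI[of _ "[]"]) (simp add: awalk_Nil_iff)
next
  case (Suc k)
  then obtain z where z: "(x, z) \<in> ((parcs G)\<^sup>=) ^^ k" "(z, y) \<in> (parcs G)\<^sup>=" by auto
  then obtain p where p: "awalk x p z" "length p \<le> k" using Suc.IH by blast
  show ?case
  proof (cases "z = y")
    case True
    then show ?thesis using p by (intro exI[of _ p]) simp
  next
    case False
    then have "awalk z [(z, y)] y" using z by (auto intro: arc_implies_awalk[of "(z, y)", simplified])
    then have "awalk x (p @ [(z, y)]) y" using p by auto
    then show ?thesis using p by (intro exI[of _ "p @ [(z, y)]"]) simp
  qed
qed

text \<open>Translates distances into the relation powers of \<open>isometric_ring\<close>;
  stationary steps pad a shorter walk to exactly \<open>k\<close> steps.\<close>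

lemma graph_dist_le_iff:
  assumes "pair_wf_digraph G" and "x \<in> pverts G"
  shows "graph_dist G x y \<le> ereal (real k) \<longleftrightarrow> (x, y) \<in> ((parcs G)\<^sup>=) ^^ k"
proof -
  interpret pair_wf_digraph G by fact
  show ?thesis
  proof
    assume "graph_dist G x y \<le> ereal (real k)"
    \<comment> \<open>The strict bound yields an actual walk from the infimum; its length, an
      integer below \<open>k + 1\<close>, is at most \<open>k\<close>.\<close>
    then have "graph_dist G x y < ereal (real k + 1)"
      by (rule le_less_trans) simp
    then obtain p where p: "awalk x p y" "real (length p) < real k + 1"
      by (auto simp: graph_dist_def \<mu>_def INF_less_iff awalk_cost_one)
    have "length p \<le> k" using p(2) by linarith
    from relpow_refl_mono[OF this awalk_relpow[OF p(1)]] show "(x, y) \<in> ((parcs G)\<^sup>=) ^^ k" .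
  next
    assume "(x, y) \<in> ((parcs G)\<^sup>=) ^^ k"
    then obtain p where p: "awalk x p y" "length p \<le> k" using relpow_refl_awalk assms by blast
    have "graph_dist G x y \<le> ereal (real (length p))"
      using min_cost_le_walk_cost[OF p(1), of "\<lambda>_. 1"] by (simp add: graph_dist_def awalk_cost_one)
    also have "\<dots> \<le> ereal (real k)" using p by simp
    finally show "graph_dist G x y \<le> ereal (real k)" .
  qed
qed

section \<open>Indexing a cycle by the integers\<close>

lemma pcas_nth:
  assumes "pcas u p v" "i < length p"
  shows "snd (p ! i) = (if Suc i < length p then fst (p ! Suc i) else v)"
  using assms
proof (induction p arbitrary: u i)
  case (Cons e p)
  then show ?case by (cases i; cases p) auto
qed simp

lemma pcas_hd: "pcas u p v \<Longrightarrow> p \<noteq> [] \<Longrightarrow> fst (p ! 0) = u"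
  by (cases p) auto

text \<open>\<open>c x\<close> is the tail of the arc at position \<open>x\<close> modulo the
  length; as the walk is closed, that arc ends at \<open>c (x + 1)\<close> even at the end of the
  list.\<close>

lemma cycle_parametrization:
  assumes "pair_wf_digraph G" and "graph_cycle G p"
  obtains c :: "int \<Rightarrow> 'a"
  where "\<And>x y. c x = c y \<longleftrightarrow> int (length p) dvd x - y"
    and "set p = range (\<lambda>x. (c x, c (x + 1)))"
    and "set p \<subseteq> parcs G"
proof -
  interpret pair_wf_digraph G by fact
  obtain u where u: "awalk u p u" "distinct (tl (pawalk_verts u p))" "p \<noteq> []"
    using assms(2) by (auto simp: graph_cycle_def cycle_def)
  have cas: "pcas u p u" and sub: "set p \<subseteq> parcs G" using u by (auto simp: awalk_def)
  \<comment> \<open>Without its first vertex, the vertex list of the walk is the list of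
    heads.\<close>
  have dist: "distinct (map snd p)"
    using u(2,3) awalk_verts_conv'[OF cas] by simp
  define q where "q = length p"
  have q: "0 < q" using u(3) by (simp add: q_def)
  define c where "c x = fst (p ! nat (x mod int q))" for x
  have idx: "nat (x mod int q) < length p" for x
    using q by (simp add: q_def nat_less_iff)
  have c_Suc: "c (x + 1) = snd (p ! nat (x mod int q))" for x
  proof -
    define i where "i = x mod int q"
    have i: "0 \<le> i" "i < int q" using q by (auto simp: i_def)
    have "(x + 1) mod int q = (i + 1) mod int q" by (simp add: i_def mod_add_left_eq)
    also have "\<dots> = (if i + 1 < int q then i + 1 else 0)"
      using i by (cases "i + 1 = int q") auto
    finally have e: "(x + 1) mod int q = (if i + 1 < int q then i + 1 else 0)" .
    show ?thesis
    proof (cases "i + 1 < int q")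
      case True
      then have "Suc (nat i) < length p" "nat (i + 1) = Suc (nat i)" using i by (auto simp: q_def)
      then show ?thesis using pcas_nth[OF cas idx[of x]] e True by (simp add: c_def i_def)
    next
      \<comment> \<open>The last arc returns to \<open>u\<close>, the tail of the arc at position
        0.\<close>
      case False
      then have "\<not> Suc (nat i) < length p" using i by (auto simp: q_def)
      then show ?thesis
        using pcas_nth[OF cas idx[of x]] e False pcas_hd[OF cas u(3)] by (simp add: c_def i_def)
    qed
  qed
  have arc: "p ! nat (x mod int q) = (c x, c (x + 1))" for x
    unfolding c_Suc by (simp add: c_def)
  have "c x = c y \<longleftrightarrow> int q dvd x - y" for x y
  proof
    assume "c x = c y"
    \<comment> \<open>Distinctness is known for heads, so \<open>c x\<close> is read as the head of
      the arc indexed \<open>x - 1\<close>.\<close>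
    then have "map snd p ! nat ((x - 1) mod int q) = map snd p ! nat ((y - 1) mod int q)"
      using c_Suc[of "x - 1"] c_Suc[of "y - 1"] idx by simp
    then have "nat ((x - 1) mod int q) = nat ((y - 1) mod int q)"
      using nth_eq_iff_index_eq[OF dist] idx by simp
    then have "(x - 1) mod int q = (y - 1) mod int q"
      using q by (simp add: eq_nat_nat_iff)
    then show "int q dvd x - y" by (simp add: mod_eq_dvd_iff)
  next
    assume "int q dvd x - y"
    then show "c x = c y" by (simp add: c_def flip: mod_eq_dvd_iff)
  qed
  moreover have "set p = range (\<lambda>x. (c x, c (x + 1)))"
  proof
    show "set p \<subseteq> range (\<lambda>x. (c x, c (x + 1)))"
    proof
      fix e assume "e \<in> set p"
      then obtain i where i: "i < length p" "e = p ! i" by (auto simp: in_set_conv_nth)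
      then have "e = (c (int i), c (int i + 1))" using arc[of "int i"] by (simp add: q_def)
      then show "e \<in> range (\<lambda>x. (c x, c (x + 1)))" by blast
    qed
    show "range (\<lambda>x. (c x, c (x + 1))) \<subseteq> set p"
      using idx by (auto simp flip: arc)
  qed
  ultimately show thesis using sub unfolding q_def by (rule that)
qed

text \<open>A walk of \<open>k\<close> steps bounds the distance in \<open>G\<close> by
  \<open>k\<close>, and by isometry also that in the cycle; a walk inside the cycle shifts the index
  by at most one per step.\<close>

lemma isometric_cycle_parametrization:
  assumes wf: "pair_wf_digraph G" and "isometric_cycle G p"
  obtains c :: "int \<Rightarrow> 'a"
  where "\<And>x y. c x = c y \<longleftrightarrow> int (length p) dvd x - y"
    and "\<And>x. (c x, c (x + 1)) \<in> parcs G"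
    and "\<And>x y k. (c x, c y) \<in> ((parcs G)\<^sup>=) ^^ k
      \<Longrightarrow> \<exists>m. \<bar>m\<bar> \<le> int k \<and> int (length p) dvd y - x - m"
proof -
  have cyc: "graph_cycle G p"
    and iso: "\<And>x y. x \<in> pverts (cycle_graph p) \<Longrightarrow> y \<in> pverts (cycle_graph p)
      \<Longrightarrow> graph_dist (cycle_graph p) x y = graph_dist G x y"
    using assms(2) by (auto simp: isometric_cycle_def)
  obtain c where c: "\<And>x y. c x = c y \<longleftrightarrow> int (length p) dvd x - y"
    and p: "set p = range (\<lambda>x. (c x, c (x + 1)))" and sub: "set p \<subseteq> parcs G"
    using cycle_parametrization[OF wf cyc] by blast
  define H where "H = cycle_graph p"
  have V: "pverts H = range c" by (auto simp: H_def cycle_graph_def p image_image)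
  have E: "(u, v) \<in> parcs H \<longleftrightarrow> (\<exists>x. u = c x \<and> v = c (x + 1) \<or> v = c x \<and> u = c (x + 1))" for u v
    by (auto simp: H_def cycle_graph_def p)
  have wfH: "pair_wf_digraph H"
    by unfold_locales (auto simp: E V split: prod.splits)
  have step: "\<exists>m. \<bar>m\<bar> \<le> 1 \<and> v = c (x + m)" if "(c x, v) \<in> (parcs H)\<^sup>=" for x v
  proof -
    \<comment> \<open>In the last two cases \<open>y\<close> is only congruent to \<open>x\<close>
      or \<open>x - 1\<close>; periodicity re-indexes the arc at \<open>x\<close>.\<close>
    consider "v = c x" | y where "c x = c y" "v = c (y + 1)" | y where "v = c y" "c x = c (y + 1)"
      using \<open>(c x, v) \<in> (parcs H)\<^sup>=\<close> by (auto simp: E)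
    then show ?thesis
    proof cases
      case 1
      then show ?thesis by (intro exI[of _ 0]) simp
    next
      case 2
      from 2(1)[symmetric] have "c (y + 1) = c (x + 1)" unfolding c by simp
      then show ?thesis using 2 by (intro exI[of _ 1]) simp
    next
      case 3
      from 3(2) have "c (x - 1) = c y" unfolding c by (simp add: algebra_simps)
      then show ?thesis using 3 by (intro exI[of _ "-1"]) simp
    qed
  qed
  have walk: "\<exists>m. \<bar>m\<bar> \<le> int k \<and> v = c (x + m)" if "(c x, v) \<in> ((parcs H)\<^sup>=) ^^ k" for x v k
    using that
  proof (induction k arbitrary: v)
    case (Suc k)
    then obtain z where z: "(c x, z) \<in> ((parcs H)\<^sup>=) ^^ k" "(z, v) \<in> (parcs H)\<^sup>=" by auto
    then obtain m where m: "\<bar>m\<bar> \<le> int k" "z = c (x + m)" using Suc.IH by blast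
    then obtain m' where "\<bar>m'\<bar> \<le> 1" "v = c (x + m + m')" using step z by blast
    then show ?case using m by (intro exI[of _ "m + m'"]) (auto simp: add.assoc)
  qed simp
  show thesis
  proof (rule that[OF c])
    show arc: "(c x, c (x + 1)) \<in> parcs G" for x using p sub by blast
    fix x y k assume "(c x, c y) \<in> ((parcs G)\<^sup>=) ^^ k"
    moreover have "c x \<in> pverts G" using arc pair_wf_digraph.in_arcsD1[OF wf] by blast
    ultimately have "graph_dist G (c x) (c y) \<le> ereal (real k)"
      using graph_dist_le_iff[OF wf] by blast
    then have "graph_dist H (c x) (c y) \<le> ereal (real k)"
      using iso[of "c x" "c y"] V by (simp add: H_def)
    then have "(c x, c y) \<in> ((parcs H)\<^sup>=) ^^ k"
      using graph_dist_le_iff[OF wfH] V by blast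
    then obtain m where "\<bar>m\<bar> \<le> int k" "c y = c (x + m)" using walk by blast
    then show "\<exists>m. \<bar>m\<bar> \<le> int k \<and> int (length p) dvd y - x - m"
      using c by (intro exI[of _ m]) (simp add: algebra_simps)
  qed
qed

section \<open>Equator, degrees and cliques\<close>

text \<open>In \<open>enat\<close> an infinite set has supremum infinity and the empty set 0, so a
  finite positive supremum is a maximum.\<close>

lemma equator_attained:
  assumes "equator G = enat q" and "0 < q"
  shows "\<exists>p. isometric_cycle G p \<and> length p = q"
proof -
  define A where "A = (\<lambda>p. enat (length p)) ` {p. isometric_cycle G p}"
  have "Sup A = enat q" using assms(1) by (simp add: A_def equator_def)
  then have "enat q \<in> A" using assms(2) Max_in[of A]
    by (cases "A = {}"; cases "finite A") (simp_all add: Sup_enat_def zero_enat_def)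
  then show ?thesis by (auto simp: A_def)
qed

lemma out_degree_with_proj: "out_degree (with_proj G) v = card (parcs G `` {v})"
proof -
  have "out_arcs (with_proj G) v = Pair v ` (parcs G `` {v})"
    by (auto simp: out_arcs_def)
  then show ?thesis by (simp add: out_degree_def card_image inj_on_def)
qed

lemma induces_cliqueI:
  assumes "finite S" and "\<And>u v. u \<in> S \<Longrightarrow> v \<in> S \<Longrightarrow> (u, v) \<in> parcs G \<longleftrightarrow> u \<noteq> v"
  shows "induces_clique G S"
proof -
  have eq: "induce_subgraph (with_proj G) S
      = with_proj \<lparr>pverts = S, parcs = {e \<in> parcs G. fst e \<in> S \<and> snd e \<in> S}\<rparr>"
    by (simp add: induce_subgraph_def with_proj_def)
  show ?thesis
    unfolding induces_clique_def eq complete_digraph_pair_def using assms by auto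
qed

section \<open>From integer-indexed layers to the partition\<close>

theorem theorem29:
  fixes G :: "'a pair_pre_digraph" and \<delta> q :: nat
  assumes "equatorial_graph G \<delta> 3 q"
    and "regular G \<delta>"
  shows "([q = 0] (mod 3) \<or> [\<delta> = 2] (mod 3)) \<and>
    (\<exists>L :: nat \<Rightarrow> 'a set.
       (\<Union>i<q. L i) = pverts G \<and>
       disjoint_family_on L {..<q} \<and>
       (\<forall>i<q. L i \<noteq> {}) \<and>
       (\<forall>i<q. induces_clique G (L i)) \<and>
       (\<forall>u v. (u, v) \<in> parcs G \<longleftrightarrow>
          (\<exists>i<q. (u \<in> L i \<and> v \<in> L i \<and> u \<noteq> v) \<or>
                 (u \<in> L i \<and> v \<in> L ((i + 1) mod q)) \<or>
                 (v \<in> L i \<and> u \<in> L ((i + 1) mod q)))) \<and>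
       ([q = 0] (mod 3) \<longrightarrow>
          (\<exists>n :: nat \<Rightarrow> nat. (\<forall>j<3. n j > 0) \<and> n 0 + n 1 + n 2 = \<delta> + 1 \<and>
             (\<forall>i<q. \<forall>j<3. [i = j] (mod 3) \<longrightarrow> card (L i) = n j))) \<and>
       (\<not> [q = 0] (mod 3) \<longrightarrow>
          (\<forall>i<q. real (card (L i)) = (real \<delta> + 1) / 3)))"
proof -
  \<comment> \<open>Radius 1 turns the equator bound into \<open>q > 9\<close>, that is
    \<open>10 \<le> q\<close>.\<close>
  have "moore_radius 3 = 1"
  proof -
    have "\<lceil>3 / 2 :: real\<rceil> = 2" by linarith
    then show ?thesis by (simp add: moore_radius_def)
  qed
  then have G: "pair_graph G" and eq: "equator G = enat q" and q: "10 \<le> q"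
    and card: "real (card (pverts G)) = real q / 3 * real (\<delta> + 1)"
    using assms(1) by (auto simp: equatorial_graph_def moore_bound_girth_3)
  interpret pair_graph G by (rule G)
  obtain p where p: "isometric_cycle G p" "length p = q"
    using equator_attained[OF eq] q by auto
  obtain c :: "int \<Rightarrow> 'a" where c: "\<And>x y. c x = c y \<longleftrightarrow> int q dvd x - y"
    "\<And>x. (c x, c (x + 1)) \<in> parcs G"
    "\<And>x y k. (c x, c y) \<in> ((parcs G)\<^sup>=) ^^ k \<Longrightarrow> \<exists>m. \<bar>m\<bar> \<le> int k \<and> int q dvd y - x - m"
    by (rule isometric_cycle_parametrization[OF pair_wf_digraph p(1), unfolded p(2)]) (rule that)
  interpret isometric_ring "pverts G" "parcs G" c q \<delta>
  proof
    show "finite (pverts G)" by (rule pair_finite_verts)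
    show "parcs G \<subseteq> pverts G \<times> pverts G" using wellformed' by auto
    show "sym (parcs G)" using pair_sym_arcs by (simp add: symmetric_def)
    show "irrefl (parcs G)" using pair_no_loops by (fastforce simp: irrefl_def)
    show "card (parcs G `` {v}) = \<delta>" if "v \<in> pverts G" for v
      using assms(2) that by (simp add: regular_def flip: out_degree_with_proj)
    have "real (3 * card (pverts G)) = real (q * (\<delta> + 1))"
      using card by (simp add: field_simps)
    then show "3 * card (pverts G) = q * (\<delta> + 1)" by (simp only: of_nat_eq_iff)
  qed (fact q c)+
  \<comment> \<open>The parts are the layers of one period; \<open>L_next\<close> turns the cyclic
    successor back into the integer index \<open>i + 1\<close>.\<close>
  define L where "L i = layer (int i)" for i
  have ex_L: "\<exists>i<q. v \<in> L i" if v: "v \<in> pverts G" for v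
  proof -
    obtain x where "v \<in> layer x" using ex_layer[OF v] by blast
    then have "v \<in> L (nat (x mod int q))" using q by (simp add: L_def layer_mod)
    moreover have "nat (x mod int q) < q" using q by (simp add: nat_less_iff)
    ultimately show ?thesis by blast
  qed
  have L_next: "L ((i + 1) mod q) = layer (int i + 1)" for i
    using layer_mod[of "int i + 1"] by (simp add: L_def zmod_int algebra_simps)
  have L_pos: "card (L i) > 0" for i
    using c_in_layer finite_layer by (auto simp: L_def card_gt_0_iff)
  have cover: "(\<Union>i<q. L i) = pverts G"
    using ex_L layer_subset by (fastforce simp: L_def)
  have disjoint: "disjoint_family_on L {..<q}"
    unfolding disjoint_family_on_def
  proof (intro ballI impI)
    fix i j assume ij: "i \<in> {..<q}" "j \<in> {..<q}" "i \<noteq> j"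
    have "\<bar>int j - int i\<bar> < int q" using ij by auto
    then have "\<not> int q dvd int j - int i"
      using dvd_imp_eq_of_abs_less[of "int q" "int j" "int i"] ij by auto
    then show "L i \<inter> L j = {}" using layer_disjoint by (auto simp: L_def)
  qed
  have nonempty: "\<forall>i<q. L i \<noteq> {}" using c_in_layer by (auto simp: L_def)
  have cliques: "\<forall>i<q. induces_clique G (L i)"
    using edge_iff finite_layer by (auto simp: L_def intro!: induces_cliqueI bexI[of _ 0])
  have edges: "(u, v) \<in> parcs G \<longleftrightarrow>
      (\<exists>i<q. (u \<in> L i \<and> v \<in> L i \<and> u \<noteq> v) \<or> (u \<in> L i \<and> v \<in> L ((i + 1) mod q)) \<or>
             (v \<in> L i \<and> u \<in> L ((i + 1) mod q)))" (is "_ \<longleftrightarrow> ?R") for u v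
  proof
    assume uv: "(u, v) \<in> parcs G"
    then obtain i j where i: "i < q" "u \<in> L i" and j: "j < q" "v \<in> L j"
      using ex_L wellformed' by meson
    have "u \<noteq> v" "\<exists>m\<in>{-1..1}. int q dvd int j - int i - m"
      using edge_iff[of u "int i" v "int j"] i j uv by (auto simp: L_def)
    then obtain m where m: "m \<in> {-1..1}" "int q dvd int j - int i - m" by blast
    consider "m = 0" | "m = 1" | "m = -1" using m(1) by force
    then show ?R
    proof cases
      case 1
      then have "L j = L i" using m unfolding L_def by (intro layer_cong) simp
      then show ?thesis using i j \<open>u \<noteq> v\<close> by blast
    next
      case 2
      then have "L j = layer (int i + 1)" using m unfolding L_def
        by (intro layer_cong) (simp add: algebra_simps)
      then show ?thesis using i j L_next by blast
    next
      \<comment> \<open>Here the layer of \<open>v\<close> precedes that of \<open>u\<close>, so the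
        witness is \<open>j\<close> in the third alternative.\<close>
      case 3
      then have "layer (int j + 1) = L i" using m unfolding L_def
        by (intro layer_cong) (simp add: algebra_simps)
      then show ?thesis using i j L_next by blast
    qed
  next
    have adj: "(x, y) \<in> parcs G" if "x \<in> L i" "y \<in> layer (int i + 1)" for x y i
    proof -
      \<comment> \<open>Consecutive layers share no vertex, as \<open>q\<close> does not divide
        1.\<close>
      have "x \<noteq> y" using layer_disjoint[of x "int i" "int i + 1"] that q by (auto simp: L_def)
      then show ?thesis using edge_iff[of x "int i" y "int i + 1"] that
        by (auto simp: L_def intro!: bexI[of _ 1])
    qed
    have clique: "(x, y) \<in> parcs G" if "x \<in> L i" "y \<in> L i" "x \<noteq> y" for x y i
      using edge_iff[of x "int i" y "int i"] that by (auto simp: L_def intro!: bexI[of _ 0])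
    assume ?R
    then obtain i where "u \<in> L i \<and> v \<in> L i \<and> u \<noteq> v \<or> u \<in> L i \<and> v \<in> layer (int i + 1)
        \<or> v \<in> L i \<and> u \<in> layer (int i + 1)"
      unfolding L_next by blast
    then show "(u, v) \<in> parcs G"
      by (elim disjE conjE) (blast intro: clique adj symD[OF sym_E])+
  qed
  have card_mod_3: "\<exists>n :: nat \<Rightarrow> nat. (\<forall>j<3. n j > 0) \<and> n 0 + n 1 + n 2 = \<delta> + 1 \<and>
             (\<forall>i<q. \<forall>j<3. [i = j] (mod 3) \<longrightarrow> card (L i) = n j)"
  \<comment> \<open>The first three layers supply the sizes; they form the window centred at
    1.\<close>
  proof (intro exI[of _ "\<lambda>j. card (L j)"] conjI allI impI)
    show "card (L 0) + card (L 1) + card (L 2) = \<delta> + 1"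
      using card_layers[of 1] by (simp add: L_def)
    fix i j :: nat assume "[i = j] (mod 3)"
    then have "3 dvd int i - int j" by (simp add: cong_iff_dvd_diff flip: cong_int_iff)
    then show "card (L i) = card (L j)" unfolding L_def by (rule card_layer_cong3)
  qed (rule L_pos)
  have card_L: "3 * card (L i) = \<delta> + 1" if "\<not> [q = 0] (mod 3)" for i
  proof -
    have "\<not> 3 dvd q" using that by (simp add: cong_0_iff)
    then have "card (layer (int i - 1)) = card (layer (int i))"
      "card (layer (int i + 1)) = card (layer (int i))"
      by (rule card_layer_const)+
    then show ?thesis using card_layers[of "int i"] by (simp add: L_def)
  qed
  have card_const: "real (card (L i)) = (real \<delta> + 1) / 3" if "\<not> [q = 0] (mod 3)" for i
    using arg_cong[OF card_L[OF that, of i], of real] by simp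
  \<comment> \<open>Three layers of equal size make \<open>\<delta> + 1\<close> divisible by
    3.\<close>
  have degree_mod_3: "[\<delta> = 2] (mod 3)" if "\<not> [q = 0] (mod 3)"
    using card_L[OF that, of 0] unfolding cong_def by presburger
  show ?thesis
  proof (intro conjI exI[of _ L])
    show "[q = 0] (mod 3) \<or> [\<delta> = 2] (mod 3)" using degree_mod_3 by blast
    show "[q = 0] (mod 3) \<longrightarrow> (\<exists>n :: nat \<Rightarrow> nat. (\<forall>j<3. n j > 0) \<and> n 0 + n 1 + n 2 = \<delta> + 1 \<and>
             (\<forall>i<q. \<forall>j<3. [i = j] (mod 3) \<longrightarrow> card (L i) = n j))"
      by (intro impI card_mod_3)
    show "\<not> [q = 0] (mod 3) \<longrightarrow> (\<forall>i<q. real (card (L i)) = (real \<delta> + 1) / 3)"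
      using card_const by simp
  qed (fact cover disjoint nonempty cliques | intro allI, fact edges)+
qed

end
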